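(* Let $X$ be a finite set with $n\ge1$ elements, let $\mathcal{F}$ be a union-closed family of subsets of $X$ with $\bigcup_{f\in\mathcal{F}}f=X$, and let $g\in\mathcal{F}$. Then the set $\{\varphi_u(g): u \text{ a word listing the elements of } X\}$ is equal to $\max(\mathrm{Fib}(g))$.
   Context: Union-closed: $f,g\in\mathcal{F}\Rightarrow f\cup g\in\mathcal{F}$. $\min(\mathcal{F})$ is the set of inclusion-minimal members of $\mathcal{F}$ and $\min(\mathcal{F})^{\uparrow}=\{z\subseteq X:\exists h\in\min(\mathcal{F}),\ h\subseteq z\}$. For $z\in\min(\mathcal{F})^{\uparrow}$ put $z^*=\bigcup_{\{h\in\mathcal{F}:h\subseteq z\}}h\in\mathcal{F}$, and for $g\in\mathcal{F}$ let $\mathrm{Fib}(g)=\{z\in\min(\mathcal{F})^{\uparrow}: z^*=g\}$; $\max(\mathrm{Fib}(g))$ is its set of inclusion-maximal elements. Rising functions: for $T\subseteq 2^X$ and $a\in X$, $\varphi_{T,a}(z)=z\cup\{a\}$ if $z\cup\{a\}\notin T$, and $\varphi_{T,a}(z)=z$ otherwise. For a word $u=b_1\cdots b_n$ (an ordering of all elements of $X$), set $\varphi_0=\mathrm{id}$, $\mathcal{F}_0=\mathcal{F}$, $\varphi_j=\varphi_{\mathcal{F}_{j-1},b_j}\circ\varphi_{j-1}$, $\mathcal{F}_j=\varphi_j(\mathcal{F})$, and $\varphi_u=\varphi_n$. *)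

theory Defs
  imports Main "HOL-Combinatorics.Multiset_Permutations"
begin

definition union_closed :: "'a set set \<Rightarrow> bool" where
  "union_closed F \<longleftrightarrow> (\<forall>f\<in>F. \<forall>g\<in>F. f \<union> g \<in> F)"

definition min_members :: "'a set set \<Rightarrow> 'a set set" where
  "min_members F = {h \<in> F. \<forall>f\<in>F. f \<subseteq> h \<longrightarrow> f = h}"

definition max_members :: "'a set set \<Rightarrow> 'a set set" where
  "max_members F = {h \<in> F. \<forall>f\<in>F. h \<subseteq> f \<longrightarrow> f = h}"

definition up_closure :: "'a set \<Rightarrow> 'a set set \<Rightarrow> 'a set set" where
  "up_closure X H = {z. z \<subseteq> X \<and> (\<exists>h\<in>H. h \<subseteq> z)}"

definition star :: "'a set set \<Rightarrow> 'a set \<Rightarrow> 'a set" where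
  "star F z = \<Union>{h \<in> F. h \<subseteq> z}"

definition Fib :: "'a set \<Rightarrow> 'a set set \<Rightarrow> 'a set \<Rightarrow> 'a set set" where
  "Fib X F g = {z \<in> up_closure X (min_members F). star F z = g}"

definition rising :: "'a set set \<Rightarrow> 'a \<Rightarrow> 'a set \<Rightarrow> 'a set" where
  "rising T a z = (if insert a z \<notin> T then insert a z else z)"

text \<open>
  \<open>rising_step F u j\<close> is the map \<open>\<phi>\<^sub>j\<close> obtained from the first \<open>j\<close> letters of the word \<open>u\<close>;
  the family \<open>\<F>\<^sub>j\<close> is \<open>rising_step F u j ` F\<close>. Lists are indexed from 0, so the letter
  \<open>b\<^sub>j\<^sub>+\<^sub>1\<close> is \<open>u ! j\<close>.
\<close>

primrec rising_step :: "'a set set \<Rightarrow> 'a list \<Rightarrow> nat \<Rightarrow> 'a set \<Rightarrow> 'a set" where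
  "rising_step F u 0 = id"
| "rising_step F u (Suc j) = rising (rising_step F u j ` F) (u ! j) \<circ> rising_step F u j"

definition rising_word :: "'a set set \<Rightarrow> 'a list \<Rightarrow> 'a set \<Rightarrow> 'a set" where
  "rising_word F u = rising_step F u (length u)"

end

theory Submission
  imports Defs
begin

text \<open>
  If a family is closed under \<open>z \<mapsto> h \<union> z\<close>, then so is its image under a rising function.
  Hence every \<open>\<F>\<^sub>j\<close> absorbs the members of \<open>\<F>\<close> and the singletons of the letters already read.
  The first kind of absorption shows that \<open>\<phi>\<^sub>j(g)\<close> contains no larger member of \<open>\<F>\<close>: if
  \<open>h\<close> were to become a subset by the addition of \<open>b\<^sub>j\<close>, then \<open>\<phi>\<^sub>j\<^sub>-\<^sub>1(g) \<union> {b\<^sub>j}\<close> would be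
  \<open>h \<union> \<phi>\<^sub>j\<^sub>-\<^sub>1(g) \<in> \<F>\<^sub>j\<^sub>-\<^sub>1\<close>, and the rising function would not have added \<open>b\<^sub>j\<close>. So
  \<open>\<phi>\<^sub>u(g)\<^sup>* = g\<close>. The second kind shows that \<open>\<phi>\<^sub>u(g) \<union> {x}\<close> is some \<open>\<phi>\<^sub>u(f)\<close>, whose star
  \<open>f\<close> is not \<open>g\<close> if \<open>x \<notin> \<phi>\<^sub>u(g)\<close>; this is maximality. Conversely, a maximal \<open>z\<close> in the
  fibre of \<open>g\<close> is \<open>\<phi>\<^sub>u(g)\<close> for any word \<open>u\<close> beginning with the elements of \<open>z - g\<close>.
\<close>

definition absorbs :: "'a set set \<Rightarrow> 'a set \<Rightarrow> bool" where
  "absorbs T h \<longleftrightarrow> (\<forall>z\<in>T. h \<union> z \<in> T)"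

text \<open>This is up-compression at \<open>a\<close>: of each pair \<open>w - {a}\<close>,
  \<open>insert a w\<close>, a lone member of \<open>T\<close> ends up as the upper set, while a
  pair lying wholly in \<open>T\<close> stays.\<close>

lemma rising_image_iff:
  "w \<in> rising T a ` T \<longleftrightarrow> (if a \<in> w then w \<in> T \<or> w - {a} \<in> T else w \<in> T \<and> insert a w \<in> T)"
proof (cases "a \<in> w")
  case True
  have "w \<in> T \<or> w - {a} \<in> T" if w: "w \<in> rising T a ` T"
  proof -
    obtain z where z: "z \<in> T" "w = rising T a z"
      using w by blast
    show ?thesis
    proof (cases "w = z")
      case False
      then have "w = insert a z" "a \<notin> z"
        using z(2) by (auto simp: rising_def split: if_splits)
      then show ?thesis
        using z(1) by simp
    qed (use z(1) in simp)
  qed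
  moreover have "w \<in> rising T a ` T" if "w \<in> T"
    using True that by (intro image_eqI[of _ _ w]) (simp_all add: rising_def insert_absorb)
  moreover have "w \<in> rising T a ` T" if "w \<notin> T" "w - {a} \<in> T"
    using True that
    by (intro image_eqI[of _ _ "w - {a}"]) (simp_all add: rising_def insert_absorb)
  ultimately show ?thesis
    using True by (simp only: if_True) blast
next
  case False
  have "w \<in> T \<and> insert a w \<in> T" if w: "w \<in> rising T a ` T"
  proof -
    obtain z where z: "z \<in> T" "w = rising T a z"
      using w by blast
    then have "insert a z \<in> T" "w = z"
      using False by (auto simp: rising_def split: if_splits)
    then show ?thesis
      using z(1) by simp
  qed
  moreover have "w \<in> rising T a ` T" if "w \<in> T" "insert a w \<in> T"
    using that by (intro image_eqI[of _ _ w]) (simp_all add: rising_def)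
  ultimately show ?thesis
    using False by (simp only: if_False) blast
qed

lemma absorbs_rising_image:
  assumes "absorbs T h"
  shows "absorbs (rising T a ` T) h"
  unfolding absorbs_def
proof
  fix w assume "w \<in> rising T a ` T"
  then have w: "if a \<in> w then w \<in> T \<or> w - {a} \<in> T else w \<in> T \<and> insert a w \<in> T"
    by (simp only: rising_image_iff)
  have abs: "h \<union> z \<in> T" if "z \<in> T" for z
    using assms that by (simp add: absorbs_def)
  have "if a \<in> h \<union> w then h \<union> w \<in> T \<or> h \<union> w - {a} \<in> T else h \<union> w \<in> T \<and> insert a (h \<union> w) \<in> T"
  proof (cases "a \<in> w")
    case True
    \<comment> \<open>The alternatives are \<open>a \<in> h\<close> and
      \<open>a \<notin> h\<close>.\<close>
    have "h \<union> (w - {a}) = h \<union> w \<or> h \<union> (w - {a}) = h \<union> w - {a}"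
      by blast
    moreover have "h \<union> w \<in> T \<or> h \<union> (w - {a}) \<in> T"
      using w True abs by (simp only: if_True) blast
    ultimately have "h \<union> w \<in> T \<or> h \<union> w - {a} \<in> T"
      by (elim disjE) (simp_all only: simp_thms)
    then show ?thesis
      using True by simp
  next
    case False
    then have "h \<union> w \<in> T" "insert a (h \<union> w) \<in> T"
      using w abs[of w] abs[of "insert a w"] by simp_all
    then show ?thesis
      by simp
  qed
  then show "h \<union> w \<in> rising T a ` T"
    by (simp only: rising_image_iff)
qed

text \<open>After compression at \<open>a\<close>, the lower set of a pair survives only together
  with the upper one.\<close>

lemma absorbs_rising_letter: "absorbs (rising T a ` T) {a}"
  unfolding absorbs_def
proof
  fix w assume "w \<in> rising T a ` T"
  then show "{a} \<union> w \<in> rising T a ` T"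
    by (cases "a \<in> w") (simp_all add: insert_absorb rising_image_iff)
qed

lemma rising_step_Suc_image:
  "rising_step F u (Suc j) ` F
    = rising (rising_step F u j ` F) (u ! j) ` (rising_step F u j ` F)"
  by (simp add: image_comp)

lemma absorbs_rising_step_image:
  assumes "absorbs F h"
  shows "absorbs (rising_step F u j ` F) h"
proof (induction j)
  case 0
  then show ?case using assms by simp
next
  case (Suc j)
  then show ?case
    unfolding rising_step_Suc_image by (rule absorbs_rising_image)
qed

lemma absorbs_rising_step_letter:
  "i < j \<Longrightarrow> absorbs (rising_step F u j ` F) {u ! i}"
proof (induction j)
  case (Suc j)
  show ?case
    unfolding rising_step_Suc_image
    using Suc by (cases "i = j") (auto intro: absorbs_rising_letter absorbs_rising_image)
qed simp

lemma rising_step_ge: "z \<subseteq> rising_step F u j z"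
  by (induction j) (auto simp: rising_def)

lemma rising_step_le:
  "j \<le> length u \<Longrightarrow> rising_step F u j z \<subseteq> z \<union> set (take j u)"
  by (induction j) (auto simp: rising_def take_Suc_conv_app_nth split: if_splits)

lemma rising_step_mono_index: "i \<le> j \<Longrightarrow> rising_step F u i z \<subseteq> rising_step F u j z"
  by (induction j rule: dec_induct) (auto simp: rising_def)

lemma rising_step_no_larger_member:
  assumes "union_closed F" "g \<in> F" "h \<in> F" "g \<subseteq> h" "h \<subseteq> rising_step F u j g"
  shows "h = g"
  using assms(5)
proof (induction j)
  case 0
  then show ?case using assms(4) by simp
next
  case (Suc j)
  let ?w = "rising_step F u j g" and ?T = "rising_step F u j ` F"
  show ?case
  proof (cases "h \<subseteq> ?w")
    case True
    then show ?thesis by (rule Suc.IH)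
  next
    case False
    with Suc.prems have "insert (u ! j) ?w \<notin> ?T" "h \<union> ?w = insert (u ! j) ?w"
      by (auto simp: rising_def split: if_splits)
    moreover have "absorbs F h"
      using assms(1,3) by (simp add: absorbs_def union_closed_def)
    then have "h \<union> ?w \<in> ?T"
      using absorbs_rising_step_image[of F h u j] assms(2) by (simp add: absorbs_def)
    ultimately show ?thesis by simp
  qed
qed

lemma star_mono: "z \<subseteq> w \<Longrightarrow> star F z \<subseteq> star F w"
  by (auto simp: star_def)

lemma star_rising_step:
  assumes "union_closed F" "g \<in> F"
  shows "star F (rising_step F u j g) = g"
proof
  show "g \<subseteq> star F (rising_step F u j g)"
    using assms(2) rising_step_ge[of g F u j] by (auto simp: star_def)
  have "h \<subseteq> g" if h: "h \<in> F" "h \<subseteq> rising_step F u j g" for h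
  proof -
    \<comment> \<open>\<open>rising_step_no_larger_member\<close> speaks only of members above
      \<open>g\<close>, so \<open>h\<close> is replaced by \<open>g \<union> h\<close>.\<close>
    have "g \<union> h \<in> F" "g \<union> h \<subseteq> rising_step F u j g"
      using assms h rising_step_ge[of g F u j] by (auto simp: union_closed_def)
    then have "g \<union> h = g"
      using rising_step_no_larger_member[OF assms, of "g \<union> h"] by blast
    then show ?thesis by blast
  qed
  then show "star F (rising_step F u j g) \<subseteq> g"
    by (auto simp: star_def)
qed

lemma ex_min_member_subset:
  assumes "finite F" "g \<in> F"
  obtains h where "h \<in> min_members F" "h \<subseteq> g"
proof -
  obtain h where "h \<in> F" "h \<subseteq> g" "\<forall>f\<in>F. f \<subseteq> h \<longrightarrow> h = f"
    using finite_has_minimal2[OF assms] by blast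
  then show ?thesis
    by (intro that[of h]) (auto simp: min_members_def)
qed

text \<open>Once \<open>g \<subseteq> z\<close>, the up-closure condition is automatic: finiteness
  of \<open>F\<close> gives a minimal member below \<open>g\<close>, hence below
  \<open>z\<close>.\<close>

lemma Fib_iff:
  assumes "finite F" "g \<in> F"
  shows "z \<in> Fib X F g \<longleftrightarrow> z \<subseteq> X \<and> g \<subseteq> z \<and> star F z = g"
proof -
  obtain h where "h \<in> min_members F" "h \<subseteq> g"
    using ex_min_member_subset[OF assms] .
  moreover have "star F z \<subseteq> z" for z
    by (auto simp: star_def)
  ultimately show ?thesis
    by (auto simp: Fib_def up_closure_def)
qed

lemma rising_word_max_Fib:
  assumes "finite F" "F \<subseteq> Pow X" "union_closed F" "g \<in> F" "set u = X"
  shows "rising_word F u g \<in> max_members (Fib X F g)"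
proof -
  let ?z = "rising_word F u g"
  have star: "star F (rising_word F u f) = f" if "f \<in> F" for f
    using star_rising_step[OF assms(3) that] by (simp add: rising_word_def)
  have "?z \<subseteq> X"
    using rising_step_le[of "length u" u F g] assms by (auto simp: rising_word_def)
  then have "?z \<in> Fib X F g"
    using assms star rising_step_ge[of g F u "length u"]
    by (simp add: Fib_iff) (simp add: rising_word_def)
  moreover have "w = ?z" if w: "w \<in> Fib X F g" "?z \<subseteq> w" for w
  proof (rule ccontr)
    assume "w \<noteq> ?z"
    then obtain x where x: "x \<in> w" "x \<notin> ?z"
      using w(2) by blast
    moreover have "w \<subseteq> X" and w_star: "star F w = g"
      using w(1) assms by (auto simp: Fib_iff)
    ultimately obtain i where "i < length u" "u ! i = x"
      using assms(5) by (metis in_set_conv_nth subsetD)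
    then have "absorbs (rising_word F u ` F) {x}"
      using absorbs_rising_step_letter[of i "length u" F u] by (simp add: rising_word_def)
    then have "insert x ?z \<in> rising_word F u ` F"
      using assms(4) by (simp add: absorbs_def)
    then obtain f where f: "f \<in> F" "insert x ?z = rising_word F u f"
      by blast
    \<comment> \<open>The star of \<open>insert x ?z\<close> is \<open>f\<close>, squeezed between
      two stars that both equal \<open>g\<close>.\<close>
    have "star F ?z \<subseteq> star F (insert x ?z)" "star F (insert x ?z) \<subseteq> star F w"
      using w(2) x(1) by (auto intro!: star_mono)
    then have "f = g"
      using star[OF assms(4)] star[OF f(1)] f(2) w_star by auto
    then show False
      using f(2) x(2) by auto
  qed
  ultimately show ?thesis
    by (simp add: max_members_def)
qed

text \<open>No letter of the prefix is refused. A refusal needs an \<open>f\<close> in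
  \<open>F\<close> whose image is the enlarged set; this lies inside \<open>z\<close>, so
  \<open>f \<subseteq> star F z = g\<close>. But the image of such an \<open>f\<close> lies within
  \<open>g\<close> and the earlier letters, so it misses the new letter.\<close>

lemma rising_step_fibre_prefix:
  assumes "star F z = g" "g \<in> F" "g \<union> set (take j u) \<subseteq> z"
    and "j \<le> length u" "distinct u" "g \<inter> set (take j u) = {}"
  shows "rising_step F u j g = g \<union> set (take j u)"
  using assms(3-)
proof (induction j)
  case (Suc j)
  let ?a = "u ! j" and ?w = "g \<union> set (take j u)"
  have take: "set (take (Suc j) u) = insert ?a (set (take j u))"
    using Suc.prems by (simp add: take_Suc_conv_app_nth)
  have a: "?a \<notin> set (take j u)"
    using Suc.prems(2,3) by (auto simp: in_set_conv_nth nth_eq_iff_index_eq)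
  have IH: "rising_step F u j g = ?w"
    using Suc take by auto
  have "insert ?a ?w \<noteq> rising_step F u j f" if f: "f \<in> F" for f
  proof
    assume eq: "insert ?a ?w = rising_step F u j f"
    have "f \<subseteq> z"
      using rising_step_ge[of f F u j] eq Suc.prems(1) take by auto
    then have "f \<subseteq> g"
      using f assms(1) by (auto simp: star_def)
    moreover have "?a \<notin> g"
      using Suc.prems(4) take by auto
    ultimately show False
      using a eq rising_step_le[of j u F f] Suc.prems(2) by auto
  qed
  then have "insert ?a ?w \<notin> rising_step F u j ` F"
    by blast
  then show ?case
    by (simp add: IH rising_def take)
qed simp

theorem theorem4p3:
  fixes X :: "'a set" and F :: "'a set set" and g :: "'a set"
  assumes "finite X" and "card X \<ge> 1"
    and "F \<subseteq> Pow X" and "union_closed F" and "\<Union>F = X"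
    and "g \<in> F"
  shows "{rising_word F u g | u. u \<in> permutations_of_set X} = max_members (Fib X F g)"
proof (intro equalityI subsetI)
  have fin: "finite F"
    using assms(1,3) finite_subset by blast
  note max = rising_word_max_Fib[OF fin assms(3,4,6)]
  {
    fix z assume "z \<in> {rising_word F u g | u. u \<in> permutations_of_set X}"
    then show "z \<in> max_members (Fib X F g)"
      using max by (auto simp: permutations_of_set_def)
  next
    fix z assume z: "z \<in> max_members (Fib X F g)"
    then have Fib: "z \<subseteq> X" "g \<subseteq> z" "star F z = g"
      using fin assms(6) by (auto simp: max_members_def Fib_iff)
    obtain u1 where u1: "set u1 = z - g" "distinct u1"
      using finite_distinct_list[of "z - g"] assms(1) Fib(1) by (meson finite_Diff finite_subset)
    \<comment> \<open>The remaining letters, those of \<open>g\<close> included, may come in any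
      order.\<close>
    obtain u2 where u2: "set u2 = X - (z - g)" "distinct u2"
      using finite_distinct_list[of "X - (z - g)"] assms(1) by blast
    let ?u = "u1 @ u2"
    have u: "set ?u = X" "distinct ?u"
      using u1 u2 Fib(1) by auto
    have "rising_step F ?u (length u1) g = g \<union> set (take (length u1) ?u)"
      using u u1 Fib(2) by (intro rising_step_fibre_prefix[OF Fib(3) assms(6)]) auto
    also have "\<dots> = z"
      using u1 Fib(2) by auto
    \<comment> \<open>The letters of \<open>u2\<close> can only enlarge \<open>z\<close>, and the
      result is again in the fibre of \<open>g\<close>, so maximality of \<open>z\<close> forces
      equality.\<close>
    finally have "z \<subseteq> rising_word F ?u g"
      using rising_step_mono_index[of "length u1" "length ?u" F ?u g]
      by (simp add: rising_word_def)
    then have "rising_word F ?u g = z"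
      using z max[OF u(1)] by (auto simp: max_members_def)
    then show "z \<in> {rising_word F u g | u. u \<in> permutations_of_set X}"
      using u by (auto simp: permutations_of_set_def)
  }
qed

end
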